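(* Let $[K]$ be a knot type. Then $s_{CL}[K]\geq 3\sqrt{c[K]+2}$, where $s_{CL}[K]$ is the cubic lattice stick index and $c[K]$ is the crossing number (crossing index) of $[K]$.
   Context: The cubic lattice is the subset $(\mathbb{R}\times\mathbb{Z}\times\mathbb{Z})\cup(\mathbb{Z}\times\mathbb{R}\times\mathbb{Z})\cup(\mathbb{Z}\times\mathbb{Z}\times\mathbb{R})$ of $\mathbb{R}^3$. A lattice stick conformation is a polygonal knot $K$ contained in the cubic lattice (with vertices at points of $\mathbb{Z}^3$); $[K]$ denotes its knot type. A stick of $K$ is a maximal line segment contained in $K$ (of any length). $s_{CL}(K)$ is the number of sticks of $K$, and the cubic lattice stick index $s_{CL}[K]$ is the minimum of $s_{CL}(K')$ over all lattice stick conformations $K'$ of the knot type $[K]$. $c[K]$ is the minimal number of crossings over all diagrams of $[K]$.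
   Formalization: The knot type is assumed nontrivial, because the inequality fails for the trivial knot: the unit lattice square has 4 sticks and c = 0, while 3√2 > 4. *)

theory Defs
  imports "HOL-Analysis.Analysis"
begin

text \<open>Polygonal knots are closed polygons in \<open>real^3\<close> given by a cyclic list of vertices; two
  different edges share no point except a common endpoint.\<close>

definition edge :: "(real^3) list \<Rightarrow> nat \<Rightarrow> (real^3) set" where
  "edge vs i = closed_segment (vs ! i) (vs ! (Suc i mod length vs))"

definition polygon :: "(real^3) list \<Rightarrow> (real^3) set" where
  "polygon vs = (\<Union>i<length vs. edge vs i)"

definition simple_polygon :: "(real^3) list \<Rightarrow> bool" where
  "simple_polygon vs \<longleftrightarrow>
     3 \<le> length vs \<and> distinct vs \<and>
     (\<forall>i<length vs. \<forall>j<length vs. i \<noteq> j \<longrightarrow>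
        edge vs i \<inter> edge vs j =
          {vs ! i, vs ! (Suc i mod length vs)} \<inter> {vs ! j, vs ! (Suc j mod length vs)})"

definition polygonal_knot :: "(real^3) set \<Rightarrow> bool" where
  "polygonal_knot K \<longleftrightarrow> (\<exists>vs. simple_polygon vs \<and> K = polygon vs)"

definition ambient_isotopic :: "(real^3) set \<Rightarrow> (real^3) set \<Rightarrow> bool" where
  "ambient_isotopic K L \<longleftrightarrow>
     (\<exists>h. homotopic_with_canon (\<lambda>f. \<exists>g. homeomorphism UNIV UNIV f g) UNIV UNIV id h \<and> h ` K = L)"

text \<open>Every tame knot is ambient isotopic to a polygonal one, so a knot type is represented by the
  set of its polygonal members.\<close>

definition knot_type :: "(real^3) set \<Rightarrow> (real^3) set set" where
  "knot_type K = {L. polygonal_knot L \<and> ambient_isotopic K L}"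

definition trivial_knot_type :: "(real^3) set set \<Rightarrow> bool" where
  "trivial_knot_type T \<longleftrightarrow> (\<exists>L\<in>T. coplanar L)"

text \<open>Diagrams are regular projections to the first two coordinates of polygonal members of the
  knot type: there are finitely many multiple points, all of them double points, and no vertex
  lies over one. These conditions force every double point to be a transverse
  crossing of the images of two edges. Projections in other directions need no separate treatment,
  since a rotated knot has the same knot type.\<close>

definition plane_proj :: "real^3 \<Rightarrow> real^2" where
  "plane_proj x = vector [x $ 1, x $ 2]"

definition multiple_points :: "(real^3) set \<Rightarrow> (real^2) set" where
  "multiple_points K = {p. \<exists>x\<in>K. \<exists>y\<in>K. x \<noteq> y \<and> plane_proj x = p \<and> plane_proj y = p}"

definition regular_position :: "(real^3) list \<Rightarrow> bool" where
  "regular_position vs \<longleftrightarrow>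
     finite (multiple_points (polygon vs)) \<and>
     (\<forall>p \<in> multiple_points (polygon vs). card {x \<in> polygon vs. plane_proj x = p} = 2) \<and>
     (\<forall>v \<in> set vs. plane_proj v \<notin> multiple_points (polygon vs))"

definition crossing_number :: "(real^3) set set \<Rightarrow> nat" where
  "crossing_number T =
     (LEAST n. \<exists>vs. simple_polygon vs \<and> polygon vs \<in> T \<and> regular_position vs \<and>
                    n = card (multiple_points (polygon vs)))"

definition cubic_lattice :: "(real^3) set" where
  "cubic_lattice =
     {x. x $ 2 \<in> \<int> \<and> x $ 3 \<in> \<int>} \<union> {x. x $ 1 \<in> \<int> \<and> x $ 3 \<in> \<int>} \<union> {x. x $ 1 \<in> \<int> \<and> x $ 2 \<in> \<int>}"

definition lattice_stick_conformation :: "(real^3) set \<Rightarrow> bool" where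
  "lattice_stick_conformation K \<longleftrightarrow>
     (\<exists>vs. simple_polygon vs \<and> (\<forall>v \<in> set vs. \<forall>i. v $ i \<in> \<int>) \<and> K = polygon vs) \<and>
     K \<subseteq> cubic_lattice"

definition sticks :: "(real^3) set \<Rightarrow> (real^3) set set" where
  "sticks K =
     {S. (\<exists>a b. a \<noteq> b \<and> S = closed_segment a b) \<and> S \<subseteq> K \<and>
         (\<forall>a b. S \<subseteq> closed_segment a b \<and> closed_segment a b \<subseteq> K \<longrightarrow> closed_segment a b = S)}"

text \<open>A polygonal knot has finitely many sticks, so \<open>card\<close> is the actual number.\<close>

definition stick_number :: "(real^3) set \<Rightarrow> nat" where
  "stick_number K = card (sticks K)"

text \<open>The values are well-ordered, so the infimum is a minimum as soon as a lattice conformation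
  exists, which is the case for every knot type.\<close>

definition lattice_stick_index :: "(real^3) set set \<Rightarrow> enat" where
  "lattice_stick_index T = (INF L \<in> {L \<in> T. lattice_stick_conformation L}. enat (stick_number L))"

end

theory Submission
  imports Defs
begin

text \<open>Project a lattice polygon along a direction close to a coordinate axis \<open>c\<close>, i.e. apply a linear
  map that sends \<open>u\<close> to a point over \<open>(u $ a + \<epsilon> * u $ c, u $ b + \<delta> * u $ c)\<close>. Since every point of
  the polygon has at least two integral coordinates, for small nonzero \<open>\<epsilon>\<close> and \<open>\<delta>\<close> this projection
  is automatically regular, and each crossing comes from one stick parallel to \<open>a\<close> and one parallel
  to \<open>b\<close>, which determine it. If the knot is not planar, then along the polygon an \<open>a\<close>-stick is
  somewhere followed, up to \<open>c\<close>-sticks, by a \<open>b\<close>-stick, and somewhere else conversely. A suitable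
  sign of \<open>\<epsilon>\<close> makes the first pair free of crossings, and a suitable sign of \<open>\<delta>\<close> the second. So the
  crossing number is at most \<open>x * y - 2\<close> for the numbers \<open>x\<close>, \<open>y\<close> of sticks in any two directions,
  and summing over the three choices of \<open>c\<close> gives the bound.\<close>


section \<open>Ambient isotopy\<close>

lemma homeomorphism_UNIV_comp:
  fixes f h :: "'a::topological_space \<Rightarrow> 'a"
  assumes "\<exists>g. homeomorphism UNIV UNIV f g" "\<exists>g. homeomorphism UNIV UNIV h g"
  shows "\<exists>g. homeomorphism UNIV UNIV (f \<circ> h) g"
  using assms homeomorphism_compose by blast

text \<open>Precomposing the path from \<open>id\<close> to \<open>k\<close> with \<open>h\<close>
  gives a path of homeomorphisms from \<open>h\<close> to \<open>k \<circ> h\<close>, which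
  continues the path from \<open>id\<close> to \<open>h\<close>.\<close>

lemma ambient_isotopic_trans:
  assumes "ambient_isotopic K L" "ambient_isotopic L M"
  shows "ambient_isotopic K M"
proof -
  let ?P = "\<lambda>f::real^3 \<Rightarrow> real^3. \<exists>g. homeomorphism UNIV UNIV f g"
  obtain h where h: "homotopic_with_canon ?P UNIV UNIV id h" "h ` K = L"
    using assms(1) unfolding ambient_isotopic_def by blast
  obtain k where k: "homotopic_with_canon ?P UNIV UNIV id k" "k ` L = M"
    using assms(2) unfolding ambient_isotopic_def by blast
  have Ph: "?P h" using homotopic_with_imp_property[OF h(1)] by blast
  then have "continuous_map (top_of_set UNIV) (top_of_set UNIV) h"
    by (auto simp: homeomorphism_def)
  then have "homotopic_with_canon ?P UNIV UNIV (id \<circ> h) (k \<circ> h)"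
    by (rule homotopic_with_compose_continuous_map_right[OF k(1)])
      (rule homeomorphism_UNIV_comp[OF _ Ph])
  then have "homotopic_with_canon ?P UNIV UNIV id (k \<circ> h)"
    using homotopic_with_trans[OF h(1)] by simp
  moreover have "(k \<circ> h) ` K = M" using h(2) k(2) by (simp only: image_comp[symmetric])
  ultimately show ?thesis unfolding ambient_isotopic_def by blast
qed

lemma linear_injective_homeomorphism:
  fixes f :: "'a::euclidean_space \<Rightarrow> 'a"
  assumes "linear f" "inj f"
  shows "\<exists>g. homeomorphism UNIV UNIV f g"
proof -
  have "surj f" using assms by (simp add: linear_injective_imp_surjective)
  moreover obtain g where "homeomorphism (f ` UNIV) UNIV g f"
    using linear_homeomorphism_image[OF assms] .
  ultimately have "homeomorphism UNIV UNIV g f" by simp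
  then show ?thesis by (intro exI) (rule homeomorphism_symD)
qed

text \<open>The straight-line homotopy from the identity to \<open>f\<close> is linear at each time,
  so the kernel condition makes every stage injective and, in finite dimension, a
  homeomorphism.\<close>

lemma ambient_isotopic_linear:
  assumes lin: "linear f"
    and ker: "\<And>t x. \<lbrakk>0 \<le> t; t \<le> 1; (1 - t) *\<^sub>R x + t *\<^sub>R f x = 0\<rbrakk> \<Longrightarrow> x = 0"
  shows "ambient_isotopic K (f ` K)"
proof -
  let ?P = "\<lambda>f::real^3 \<Rightarrow> real^3. \<exists>g. homeomorphism UNIV UNIV f g"
  let ?h = "\<lambda>(t, x). (1 - t) *\<^sub>R x + t *\<^sub>R f x"
  have cont: "continuous_on ({0..1} \<times> UNIV) ?h"
    unfolding case_prod_beta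
    by (intro continuous_intros linear_continuous_on_compose[OF _ lin])
  have hom: "?P (\<lambda>x. (1 - t) *\<^sub>R x + t *\<^sub>R f x)" if "t \<in> {0..1}" for t
  proof (rule linear_injective_homeomorphism)
    show lin': "linear (\<lambda>x. (1 - t) *\<^sub>R x + t *\<^sub>R f x)"
      by (rule linearI) (simp_all add: linear_add[OF lin] linear_scale[OF lin] algebra_simps)
    show "inj (\<lambda>x. (1 - t) *\<^sub>R x + t *\<^sub>R f x)"
      unfolding linear_injective_0[OF lin']
    proof (intro allI impI)
      fix x assume "(1 - t) *\<^sub>R x + t *\<^sub>R f x = 0"
      then show "x = 0" using that by (intro ker[of t x]) (simp_all only: atLeastAtMost_iff)
    qed
  qed
  have "homotopic_with_canon ?P UNIV UNIV id f"
    unfolding homotopic_with_def prod_topology_subtopology_eu continuous_map_subtopology_eu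
    using cont hom by (intro exI[of _ ?h]) auto
  then show ?thesis unfolding ambient_isotopic_def by blast
qed

section \<open>Sticks\<close>

lemma closed_segment_infinite:
  fixes a b :: "'a::euclidean_space"
  assumes "a \<noteq> b" shows "infinite (closed_segment a b)"
  using assms uncountable_closed_segment countable_finite by blast

lemma collinear_subset_affine_hull_2:
  fixes S :: "'a::euclidean_space set"
  assumes "collinear S" "u \<in> S" "v \<in> S" "u \<noteq> v"
  shows "S \<subseteq> affine hull {u, v}"
proof
  fix x assume "x \<in> S"
  then have "collinear {u, v, x}" using assms by (auto intro: collinear_subset)
  then show "x \<in> affine hull {u, v}" using collinear_3_affine_hull[OF assms(4)] by blast
qed

lemma stick_maximal:
  assumes "S \<in> sticks K" "S \<subseteq> closed_segment a b" "closed_segment a b \<subseteq> K"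
  shows "closed_segment a b = S"
  using assms unfolding sticks_def mem_Collect_eq by (elim conjE) (drule spec2, erule mp, rule conjI)

text \<open>Two segments with two common points lie on one line, so their union is again a segment;
  by maximality it equals both.\<close>

lemma stick_unique:
  assumes S: "S \<in> sticks K" "T \<in> sticks K" and uv: "u \<in> S" "v \<in> S" "u \<in> T" "v \<in> T" "u \<noteq> v"
  shows "S = T"
proof -
  obtain a b where ab: "S = closed_segment a b" using S(1) by (auto simp: sticks_def)
  obtain c d where cd: "T = closed_segment c d" using S(2) by (auto simp: sticks_def)
  have "S \<union> T \<subseteq> affine hull {u, v}"
    using collinear_subset_affine_hull_2[OF _ uv(1,2,5)] collinear_subset_affine_hull_2[OF _ uv(3,4,5)]
    unfolding ab cd by auto
  then have col: "collinear (S \<union> T)" unfolding collinear_affine_hull by blast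
  have "connected (S \<union> T)" using uv unfolding ab cd by (intro connected_Un) auto
  then obtain p q where pq: "S \<union> T = closed_segment p q"
    using compact_convex_collinear_segment_alt[OF _ _ _ col] uv
    unfolding ab cd by (metis compact_Un compact_segment Un_empty empty_iff)
  have "closed_segment p q \<subseteq> K" using S unfolding pq[symmetric] by (auto simp: sticks_def)
  then have "closed_segment p q = S" "closed_segment p q = T"
    using stick_maximal[OF S(1)] stick_maximal[OF S(2)] pq by blast+
  then show ?thesis by simp
qed

text \<open>On the line through \<open>a\<close> and \<open>b\<close>, the component of
  \<open>K\<close> at \<open>a\<close> is compact, connected and collinear, hence a segment. A
  larger segment in \<open>K\<close> stays on that line and is connected, so it cannot leave the
  component.\<close>

lemma stick_exists:
  assumes K: "compact K" and ab: "a \<noteq> b" "closed_segment a b \<subseteq> K"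
  shows "\<exists>S\<in>sticks K. closed_segment a b \<subseteq> S"
proof -
  define L where "L = K \<inter> affine hull {a, b}"
  define S where "S = connected_component_set L a"
  have segL: "closed_segment a b \<subseteq> L"
    using ab unfolding L_def
    by (auto intro: collinear_subset_affine_hull_2[THEN subsetD, of "closed_segment a b"])
  have seg: "closed_segment a b \<subseteq> S"
    unfolding S_def by (intro connected_component_maximal segL) auto
  have SL: "S \<subseteq> L" unfolding S_def by (rule connected_component_subset)
  have "closed L" unfolding L_def using K by (simp add: closed_Int compact_imp_closed)
  then have "closed S" unfolding S_def by (rule closed_connected_component)
  moreover have "bounded S" using SL K unfolding L_def by (meson bounded_subset compact_imp_bounded le_infE)
  ultimately have comp: "compact S" by (simp add: compact_eq_bounded_closed)
  have col: "collinear S" unfolding collinear_affine_hull using SL L_def by blast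
  obtain c d where cd: "S = closed_segment c d"
    using compact_convex_collinear_segment_alt[OF _ comp _ col] seg
    unfolding S_def by (metis connected_connected_component ends_in_segment(1) empty_iff subsetD)
  have "c \<noteq> d" using cd seg ab(1) by (metis closed_segment_idem ends_in_segment singletonD subsetD)
  moreover have "closed_segment p q = S" if "S \<subseteq> closed_segment p q" "closed_segment p q \<subseteq> K" for p q
  proof -
    have "closed_segment p q \<subseteq> affine hull {a, b}"
      using that seg ab(1) by (intro collinear_subset_affine_hull_2) auto
    then have "closed_segment p q \<subseteq> S"
      unfolding S_def using that seg by (intro connected_component_maximal) (auto simp: L_def)
    then show ?thesis using that by blast
  qed
  moreover have "S \<subseteq> K" using SL L_def by blast
  ultimately have "S \<in> sticks K" using cd unfolding sticks_def mem_Collect_eq by metis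
  then show ?thesis using seg by blast
qed


section \<open>Lattice polygons\<close>

lemma cubic_lattice_axis:
  assumes "x \<in> cubic_lattice"
  obtains d where "\<And>i. i \<noteq> d \<Longrightarrow> x $ i \<in> \<int>"
proof -
  have "\<exists>d. \<forall>i. i \<noteq> d \<longrightarrow> x $ i \<in> \<int>"
    using assms unfolding cubic_lattice_def Un_iff mem_Collect_eq by (metis exhaust_3)
  then show ?thesis using that by blast
qed

lemma lattice_segment_axis_parallel:
  assumes p: "\<And>i. p $ i \<in> \<int>" and q: "\<And>i. q $ i \<in> \<int>"
    and sub: "closed_segment p q \<subseteq> cubic_lattice"
  shows "\<exists>d. \<forall>i. i \<noteq> d \<longrightarrow> p $ i = q $ i"
proof -
  \<comment> \<open>For this \<open>t\<close> the displacement from \<open>p\<close> is less than 1 in each coordinate,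
    so it is integral only where it is 0.\<close>
  define t :: real where "t = 1 / (norm (q - p) + 1)"
  have pos: "0 < norm (q - p) + 1" by (simp add: add_nonneg_pos)
  then have t: "0 < t" "t \<le> 1" unfolding t_def by simp_all
  have "(1 - t) *\<^sub>R p + t *\<^sub>R q \<in> cubic_lattice"
    using t by (intro subsetD[OF sub]) (unfold in_segment, intro exI[of _ t], simp)
  then obtain d where d: "\<And>i. i \<noteq> d \<Longrightarrow> ((1 - t) *\<^sub>R p + t *\<^sub>R q) $ i \<in> \<int>"
    using cubic_lattice_axis by blast
  have "p $ i = q $ i" if "((1 - t) *\<^sub>R p + t *\<^sub>R q) $ i \<in> \<int>" for i
  proof -
    have eq: "t * (q $ i - p $ i) = ((1 - t) *\<^sub>R p + t *\<^sub>R q) $ i - p $ i"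
      by (simp add: algebra_simps)
    have "t * (q $ i - p $ i) \<in> \<int>" unfolding eq using that p by (rule Ints_diff)
    moreover have "\<bar>q $ i - p $ i\<bar> < norm (q - p) + 1"
      using component_le_norm_cart[of "q - p" i] by simp
    then have "\<bar>t * (q $ i - p $ i)\<bar> < 1"
      unfolding t_def using pos by (simp add: abs_mult)
    ultimately have "t * (q $ i - p $ i) = 0" by (rule Ints_nonzero_abs_less1)
    then show ?thesis using t by simp
  qed
  then have "p $ i = q $ i" if "i \<noteq> d" for i using d[OF that] .
  then show ?thesis by (intro exI[of _ d] allI impI)
qed

text \<open>A coordinate is an affine function of the parameter along the segment; equal values at
  two different parameters force slope 0.\<close>

lemma segment_agree:
  fixes u v p q x y :: "real^'n"
  assumes "u \<in> closed_segment p q" "v \<in> closed_segment p q" "u \<noteq> v" "u $ m = v $ m"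
    "x \<in> closed_segment p q"
  shows "x $ m = u $ m"
proof -
  have *: "\<exists>t. \<forall>i. w $ i = p $ i + t * (q $ i - p $ i)" if w: "w \<in> closed_segment p q" for w
  proof -
    obtain t where t: "w = (1 - t) *\<^sub>R p + t *\<^sub>R q" using w unfolding in_segment by blast
    have "w $ i = p $ i + t * (q $ i - p $ i)" for i unfolding t by (simp add: algebra_simps)
    then show ?thesis by blast
  qed
  obtain s where s: "\<And>i. u $ i = p $ i + s * (q $ i - p $ i)" using * assms(1) by blast
  obtain t where t: "\<And>i. v $ i = p $ i + t * (q $ i - p $ i)" using * assms(2) by blast
  obtain r where r: "\<And>i. x $ i = p $ i + r * (q $ i - p $ i)" using * assms(5) by blast
  have "s \<noteq> t" using s t assms(3) by (auto simp: vec_eq_iff)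
  then have "q $ m = p $ m" using assms(4) unfolding s t by simp
  then show ?thesis unfolding r s by simp
qed

text \<open>Holds for every \<open>d\<close> when \<open>S\<close> has at most one point, so an axis
  is determined only by two distinct points of \<open>S\<close>.\<close>

definition parallel_to :: "'n \<Rightarrow> (real^'n) set \<Rightarrow> bool" where
  "parallel_to d S \<longleftrightarrow> (\<forall>u\<in>S. \<forall>v\<in>S. \<forall>i. i \<noteq> d \<longrightarrow> u $ i = v $ i)"

lemma parallel_toD: "\<lbrakk>parallel_to d S; u \<in> S; v \<in> S; i \<noteq> d\<rbrakk> \<Longrightarrow> u $ i = v $ i"
  unfolding parallel_to_def by blast

lemma parallel_to_unique:
  assumes "parallel_to d S" "parallel_to e S" "u \<in> S" "v \<in> S" "u \<noteq> v"
  shows "d = e"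
proof (rule ccontr)
  assume "d \<noteq> e"
  then have "u $ i = v $ i" for i
    using parallel_toD[OF assms(1,3,4), of i] parallel_toD[OF assms(2,3,4), of i] by (cases "i = d") auto
  then show False using assms(5) by (simp add: vec_eq_iff)
qed

locale lattice_polygon =
  fixes vs :: "(real^3) list"
  assumes simple: "simple_polygon vs"
    and integral: "\<And>v i. v \<in> set vs \<Longrightarrow> v $ i \<in> \<int>"
    and sub_lattice: "polygon vs \<subseteq> cubic_lattice"
begin

text \<open>The periodic numbering by all natural numbers lets a walk around the polygon ignore the
  return to the first vertex.\<close>

definition V :: "nat \<Rightarrow> real^3" where "V k = vs ! (k mod length vs)"

definition E :: "nat \<Rightarrow> (real^3) set" where "E k = closed_segment (V k) (V (Suc k))"

lemma length_ge: "3 \<le> length vs" and distinct: "distinct vs"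
  using simple by (auto simp: simple_polygon_def)

lemma mod_lt: "k mod length vs < length vs"
  using length_ge by (intro mod_less_divisor) linarith

lemma V_in_set: "V k \<in> set vs"
  unfolding V_def using mod_lt by (rule nth_mem)

lemma V_int: "V k $ i \<in> \<int>"
  using integral V_in_set .

lemma set_vs: "v \<in> set vs \<Longrightarrow> \<exists>k. v = V k"
  unfolding V_def in_set_conv_nth by (metis mod_less)

lemma V_eq_iff: "V j = V k \<longleftrightarrow> j mod length vs = k mod length vs"
  unfolding V_def using nth_eq_iff_index_eq[OF distinct mod_lt mod_lt] .

lemma V_neq_Suc: "V k \<noteq> V (Suc k)"
  unfolding V_eq_iff using length_ge by (auto simp: mod_Suc)

lemma edge_mod: "edge vs (k mod length vs) = E k"
  unfolding edge_def E_def V_def by (simp add: mod_Suc_eq)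

lemma polygon_E: "polygon vs = (\<Union>k. E k)"
proof
  show "polygon vs \<subseteq> (\<Union>k. E k)"
  proof
    fix x assume "x \<in> polygon vs"
    then obtain k where "k < length vs" "x \<in> edge vs k" unfolding polygon_def by blast
    then have "x \<in> E k" using edge_mod[of k] by simp
    then show "x \<in> (\<Union>k. E k)" by blast
  qed
  show "(\<Union>k. E k) \<subseteq> polygon vs"
    unfolding polygon_def using edge_mod mod_lt by blast
qed

lemma E_subset: "E k \<subseteq> polygon vs"
  using polygon_E by blast

lemma V_in_E: "V k \<in> E k" "V (Suc k) \<in> E k"
  by (auto simp: E_def)

lemma V_in_polygon: "V k \<in> polygon vs"
  using V_in_E E_subset by blast

lemma E_eq: "k mod length vs = i mod length vs \<Longrightarrow> E k = E i"
  by (simp only: edge_mod[symmetric])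

text \<open>Simplicity makes a vertex that lies on an edge one of its endpoints, and distinctness of
  the vertices then leaves only the two edges that meet there.\<close>

lemma vertex_in_edge:
  assumes "V (Suc i) \<in> E k"
  shows "k mod length vs = i mod length vs \<or> k mod length vs = Suc i mod length vs"
proof (rule ccontr)
  assume *: "\<not> ?thesis"
  then have "E i \<inter> E k = {V i, V (Suc i)} \<inter> {V k, V (Suc k)}"
    using simple mod_lt[of i] mod_lt[of k]
    unfolding simple_polygon_def edge_mod[symmetric] V_def by (simp add: mod_Suc_eq)
  then have "V (Suc i) = V k \<or> V (Suc i) = V (Suc k)"
    using assms V_in_E by blast
  then show False
    using * unfolding V_eq_iff
    by (auto simp: mod_Suc split: if_splits)
qed

lemma E_parallel_ex: "\<exists>d. parallel_to d (E k)"
proof -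
  have "\<exists>d. \<forall>i. i \<noteq> d \<longrightarrow> V k $ i = V (Suc k) $ i"
    using lattice_segment_axis_parallel[OF V_int V_int] subset_trans[OF E_subset sub_lattice]
    unfolding E_def by blast
  then obtain d where d: "\<And>i. i \<noteq> d \<Longrightarrow> V k $ i = V (Suc k) $ i" by blast
  have "x $ i = V k $ i" if "x \<in> E k" "i \<noteq> d" for x i
    using segment_agree[OF ends_in_segment V_neq_Suc d] that unfolding E_def by blast
  then show ?thesis by (intro exI[of _ d]) (simp add: parallel_to_def)
qed

lemma E_parallel_unique: "\<lbrakk>parallel_to d (E k); parallel_to e (E k)\<rbrakk> \<Longrightarrow> d = e"
  by (rule parallel_to_unique[OF _ _ V_in_E V_neq_Suc])

text \<open>Read contrapositively, a nonintegral coordinate of a point reveals the direction of its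
  edge. This is how crossings are later attributed to sticks.\<close>

lemma E_int: "\<lbrakk>parallel_to d (E k); x \<in> E k; i \<noteq> d\<rbrakk> \<Longrightarrow> x $ i \<in> \<int>"
  using parallel_toD[of d "E k" x "V k" i] V_in_E(1) V_int by simp

lemma compact_polygon: "compact (polygon vs)"
  unfolding polygon_def edge_def by (intro compact_UN) auto

text \<open>An infinite set covered by finitely many edges shares two points with one of them. The
  stick over that edge then has two points in common with \<open>S\<close>, so it is
  \<open>S\<close>.\<close>

lemma stick_contains_E:
  assumes S: "S \<in> sticks (polygon vs)"
  shows "\<exists>k. E k \<subseteq> S \<and> k < length vs"
proof -
  have "infinite S" using S closed_segment_infinite by (auto simp: sticks_def)
  moreover have "S = (\<Union>k<length vs. S \<inter> edge vs k)"
    using S unfolding sticks_def polygon_def by blast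
  ultimately obtain k where k: "k < length vs" "infinite (S \<inter> edge vs k)"
    by (metis finite_UN finite_lessThan lessThan_iff)
  then have E: "infinite (S \<inter> E k)" using edge_mod[of k] by simp
  then obtain u where u: "u \<in> S \<inter> E k" by (metis ex_in_conv finite.emptyI)
  then obtain v where v: "v \<in> S \<inter> E k" "v \<noteq> u"
    using E by (metis finite.emptyI finite.insertI finite_subset insertCI subsetI)
  obtain T where T: "T \<in> sticks (polygon vs)" "E k \<subseteq> T"
    using stick_exists[OF compact_polygon V_neq_Suc] E_subset unfolding E_def by blast
  then have "S = T" using stick_unique[OF S T(1)] u v by blast
  then show ?thesis using T k by blast
qed

lemma stick_over_E: "\<exists>S\<in>sticks (polygon vs). E k \<subseteq> S"
  using stick_exists[OF compact_polygon V_neq_Suc] E_subset unfolding E_def by blast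

text \<open>Choosing for each stick an edge inside it is injective, since two sticks over the same
  edge share two points.\<close>

lemma finite_sticks: "finite (sticks (polygon vs))"
proof -
  define f where "f S = (SOME k. E k \<subseteq> S \<and> k < length vs)" for S
  have f: "E (f S) \<subseteq> S \<and> f S < length vs" if "S \<in> sticks (polygon vs)" for S
    unfolding f_def using stick_contains_E[OF that] by (rule someI_ex)
  have "inj_on f (sticks (polygon vs))"
  proof (rule inj_onI)
    fix S T assume *: "S \<in> sticks (polygon vs)" "T \<in> sticks (polygon vs)" "f S = f T"
    have "E (f S) \<subseteq> S" "E (f S) \<subseteq> T" using f[OF *(1)] f[OF *(2)] *(3) by simp_all
    then show "S = T"
      using stick_unique[OF *(1,2) _ _ _ _ V_neq_Suc[of "f S"]] V_in_E[of "f S"] by blast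
  qed
  moreover have "f ` sticks (polygon vs) \<subseteq> {..<length vs}" using f by blast
  ultimately show ?thesis by (meson finite_imageD finite_lessThan finite_subset)
qed

section \<open>Sticks sorted by direction\<close>

definition X :: "3 \<Rightarrow> (real^3) set set" where
  "X d = {S \<in> sticks (polygon vs). parallel_to d S}"

lemma finite_X: "finite (X d)"
  using finite_sticks by (simp add: X_def)

lemma stick_parallel:
  assumes "S \<in> sticks (polygon vs)" "E k \<subseteq> S" "parallel_to d (E k)"
  shows "S \<in> X d"
proof -
  obtain p q where pq: "S = closed_segment p q" using assms(1) by (auto simp: sticks_def)
  have VS: "V k \<in> S" "V (Suc k) \<in> S" using assms(2) V_in_E by auto
  have "x $ i = V k $ i" if "x \<in> S" "i \<noteq> d" for x i
    using segment_agree[OF VS[unfolded pq] V_neq_Suc parallel_toD[OF assms(3) V_in_E]] that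
    unfolding pq by blast
  then have "parallel_to d S" by (simp add: parallel_to_def)
  then show ?thesis using assms(1) by (simp add: X_def)
qed

lemma X_over_E: "parallel_to d (E k) \<Longrightarrow> \<exists>S\<in>X d. E k \<subseteq> S"
  using stick_over_E stick_parallel by blast

lemma X_disjoint: "d \<noteq> e \<Longrightarrow> X d \<inter> X e = {}"
proof (rule ccontr)
  assume "d \<noteq> e" "X d \<inter> X e \<noteq> {}"
  then obtain S where S: "S \<in> sticks (polygon vs)" "parallel_to d S" "parallel_to e S"
    by (auto simp: X_def)
  obtain k where "E k \<subseteq> S" using stick_contains_E S(1) by blast
  then show False using parallel_to_unique[OF S(2,3)] V_in_E V_neq_Suc \<open>d \<noteq> e\<close> by blast
qed

lemma card_X_sum: "card (X 1) + card (X 2) + card (X 3) \<le> stick_number (polygon vs)"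
proof -
  have "card (X 1 \<union> X 2 \<union> X 3) = card (X 1) + card (X 2) + card (X 3)"
    using X_disjoint[of 1 2] X_disjoint[of 1 3] X_disjoint[of 2 3]
    by (subst card_Un_disjoint; simp add: finite_X Int_Un_distrib2 card_Un_disjoint)
  moreover have "card (X 1 \<union> X 2 \<union> X 3) \<le> card (sticks (polygon vs))"
    by (intro card_mono finite_sticks) (auto simp: X_def)
  ultimately show ?thesis by (simp add: stick_number_def)
qed

end


section \<open>Tilted projections of lattice polygons\<close>

lemma coplanar_coordinate_plane:
  fixes S :: "(real^3) set"
  assumes "\<And>x. x \<in> S \<Longrightarrow> x $ d = r"
  shows "coplanar S"
proof -
  obtain e f :: 3 where ef: "e \<noteq> d" "f \<noteq> d" "e \<noteq> f" "\<And>i. i = d \<or> i = e \<or> i = f"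
  proof -
    consider "d = 1" | "d = 2" | "d = 3" using exhaust_3 by blast
    then show ?thesis
    proof cases
      case 1 show ?thesis by (rule that[of 2 3]) (use 1 exhaust_3 in simp_all)
    next
      case 2 show ?thesis by (rule that[of 1 3]) (use 2 exhaust_3 in simp_all, blast)
    next
      case 3 show ?thesis by (rule that[of 1 2]) (use 3 exhaust_3 in simp_all, blast)
    qed
  qed
  \<comment> \<open>The plane is spanned affinely by \<open>u\<close> and its translates by the two
    other unit vectors; \<open>1 - x $ e - x $ f\<close>, \<open>x $ e\<close> and
    \<open>x $ f\<close> are the barycentric coordinates of \<open>x\<close>.\<close>
  define u :: "real^3" where "u = axis d r"
  have "x \<in> affine hull {u, u + axis e 1, u + axis f 1}" if "x \<in> S" for x
  proof -
    have "x $ i = ((1 - x $ e - x $ f) *\<^sub>R u + (x $ e) *\<^sub>R (u + axis e 1)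
        + (x $ f) *\<^sub>R (u + axis f 1)) $ i" for i
      using ef(4)[of i] ef(1-3) assms[OF that]
      by (auto simp: u_def axis_def algebra_simps)
    then have "x = (1 - x $ e - x $ f) *\<^sub>R u + (x $ e) *\<^sub>R (u + axis e 1)
        + (x $ f) *\<^sub>R (u + axis f 1)"
      unfolding vec_eq_iff by blast
    moreover have "(1 - x $ e - x $ f) + x $ e + x $ f = 1" by simp
    ultimately show ?thesis unfolding affine_hull_3 by blast
  qed
  then show ?thesis unfolding coplanar_def by blast
qed

text \<open>As \<open>x\<close> is nonintegral, it lies strictly between \<open>p\<close> and
  \<open>q\<close>. Hence \<open>s\<close> exceeds the smaller end minus 1 and stays below the
  larger end plus 1, and integrality closes both gaps.\<close>

lemma Ints_between:
  fixes p q s x :: real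
  assumes "p \<in> \<int>" "q \<in> \<int>" "s \<in> \<int>" "x \<notin> \<int>" "\<bar>x - s\<bar> < 1" "x \<in> closed_segment p q"
  shows "s \<in> closed_segment p q"
proof -
  obtain p' q' s' :: int where eq: "p = of_int p'" "q = of_int q'" "s = of_int s'"
    using assms(1-3) by (metis Ints_cases)
  have "x \<noteq> p" "x \<noteq> q" using assms by auto
  then have "p < x \<and> x < q \<or> q < x \<and> x < p"
    using assms(6) by (auto simp: closed_segment_eq_real_ivl split: if_splits)
  then have "real_of_int p' < s' + 1 \<and> real_of_int s' < q' + 1 \<or>
      real_of_int q' < s' + 1 \<and> real_of_int s' < p' + 1"
    using assms(5) unfolding eq by linarith
  then have "p' \<le> s' \<and> s' \<le> q' \<or> q' \<le> s' \<and> s' \<le> p'" by linarith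
  then show ?thesis unfolding eq by (auto simp: closed_segment_eq_real_ivl)
qed

lemma closed_segment_parallel_mem:
  fixes p q x :: "real^'n"
  assumes "\<And>i. i \<noteq> d \<Longrightarrow> p $ i = q $ i" "\<And>i. i \<noteq> d \<Longrightarrow> x $ i = p $ i"
    and "x $ d \<in> closed_segment (p $ d) (q $ d)"
  shows "x \<in> closed_segment p q"
proof -
  obtain t where t: "0 \<le> t" "t \<le> 1" "x $ d = (1 - t) * p $ d + t * q $ d"
    using assms(3) unfolding in_segment by auto
  have "x $ i = ((1 - t) *\<^sub>R p + t *\<^sub>R q) $ i" for i
  proof (cases "i = d")
    case False
    show ?thesis using assms(1)[OF False] assms(2)[OF False] by (simp add: algebra_simps)
  qed (use t(3) in simp)
  then have "x = (1 - t) *\<^sub>R p + t *\<^sub>R q" unfolding vec_eq_iff by blast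
  then show ?thesis unfolding in_segment using t(1,2) by blast
qed

lemma small_with_sign:
  fixes \<eta> x :: real
  obtains \<epsilon> where "\<bar>\<epsilon>\<bar> = \<bar>\<eta>\<bar>" "\<epsilon> * x \<le> 0"
proof (cases "\<eta> * x \<le> 0")
  case False
  then show ?thesis using that[of "- \<eta>"] by simp
qed (use that[of \<eta>] in simp)

context lattice_polygon
begin

section \<open>Corners of a lattice polygon and points with equal projection\<close>

lemma polygon_in_E:
  assumes "u \<in> polygon vs"
  obtains k d where "u \<in> E k" "parallel_to d (E k)"
  using assms E_parallel_ex unfolding polygon_E by blast

text \<open>Otherwise coordinate \<open>d\<close> would be constant along the whole polygon, which
  would then lie in a plane.\<close>

lemma edge_parallel_exists:
  assumes "\<not> coplanar (polygon vs)"
  shows "\<exists>k. parallel_to d (E k)"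
proof (rule ccontr)
  assume none: "\<not> ?thesis"
  have const: "x $ d = V k $ d" if "x \<in> E k" for x k
  proof -
    obtain e where "parallel_to e (E k)" using E_parallel_ex by blast
    moreover have "d \<noteq> e" using none calculation by blast
    ultimately show ?thesis using parallel_toD that V_in_E(1) by blast
  qed
  have "V k $ d = V 0 $ d" for k
  proof (induction k)
    case (Suc k)
    show ?case using const[OF V_in_E(2)[of k]] Suc by simp
  qed simp
  then have "x $ d = V 0 $ d" if "x \<in> polygon vs" for x
    using const that unfolding polygon_E by auto
  then show False using assms coplanar_coordinate_plane by blast
qed

text \<open>Take the last \<open>a\<close>-edge before a given \<open>b\<close>-edge, then the first
  \<open>b\<close>-edge after it. Only \<open>c\<close>-edges lie between, and these change no
  coordinate but \<open>c\<close>.\<close>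

lemma corner_exists:
  assumes axes: "\<And>d. d = a \<or> d = b \<or> d = c" and "a \<noteq> b"
    and k: "parallel_to a (E k)" and l: "parallel_to b (E l)"
  obtains i j where "parallel_to a (E i)" "\<not> parallel_to a (E (Suc i))" "parallel_to b (E j)"
    "\<And>m. m \<noteq> c \<Longrightarrow> V (Suc i) $ m = V j $ m"
proof -
  \<comment> \<open>Adding full turns keeps the edge but places it after \<open>k\<close>.\<close>
  define l' where "l' = l + length vs * Suc k"
  have "1 * Suc k \<le> length vs * Suc k" using length_ge by (intro mult_right_mono) linarith+
  then have kl: "k < l'" unfolding l'_def by simp
  have "E l' = E l" unfolding l'_def by (rule E_eq) (rule mod_mult_self2)
  then have l': "parallel_to b (E l')" using l by simp
  define I where "I = {i. i < l' \<and> parallel_to a (E i)}"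
  define i where "i = Max I"
  have finI: "finite I" unfolding I_def by simp
  have "k \<in> I" using kl k unfolding I_def by simp
  then have "i \<in> I" unfolding i_def using finI by (intro Max_in) auto
  then have i: "i < l'" "parallel_to a (E i)" by (auto simp: I_def)
  have max: "\<not> parallel_to a (E m)" if "i < m" "m \<le> l'" for m
  proof
    assume m: "parallel_to a (E m)"
    have "m \<noteq> l'" using E_parallel_unique m l' \<open>a \<noteq> b\<close> by blast
    then have "m \<in> I" using m that unfolding I_def by simp
    then have "m \<le> i" unfolding i_def using finI by (rule Max_ge[rotated])
    then show False using that by simp
  qed
  define j where "j = (LEAST j. i < j \<and> parallel_to b (E j))"
  have j: "i < j" "parallel_to b (E j)"
    unfolding j_def using LeastI[of "\<lambda>j. i < j \<and> parallel_to b (E j)" l'] i l' by auto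
  have jl: "j \<le> l'" unfolding j_def using i l' by (intro Least_le) auto
  have between: "parallel_to c (E m)" if "i < m" "m < j" for m
  proof -
    obtain d where d: "parallel_to d (E m)" using E_parallel_ex by blast
    have "d \<noteq> a" using max[of m] that jl d by auto
    moreover have "d \<noteq> b" using not_less_Least[of m "\<lambda>j. i < j \<and> parallel_to b (E j)"] that d
      unfolding j_def by auto
    ultimately show ?thesis using axes[of d] d by auto
  qed
  have "V (Suc i) $ m = V (Suc i + n) $ m" if "m \<noteq> c" "Suc i + n \<le> j" for m n
    using that(2)
  proof (induction n)
    case (Suc n)
    have "parallel_to c (E (Suc i + n))" using Suc.prems by (intro between) auto
    from parallel_toD[OF this V_in_E that(1)] show ?case using Suc by simp
  qed simp
  from this[of _ "j - Suc i"] have "V (Suc i) $ m = V j $ m" if "m \<noteq> c" for m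
    using j(1) that by simp
  moreover have "\<not> parallel_to a (E (Suc i))" using max[of "Suc i"] i by auto
  ultimately show ?thesis using that i j by blast
qed

text \<open>The points must differ in \<open>c\<close>, so in \<open>a\<close> and in
  \<open>b\<close> they differ by a nonzero amount below 1. Hence one of them is nonintegral in
  \<open>a\<close> and one in \<open>b\<close>, and it cannot be the same one, as each point has at
  most one nonintegral coordinate.\<close>

lemma crossing_coordinates:
  assumes axes: "\<And>d. d = a \<or> d = b \<or> d = c" and ne: "a \<noteq> b" "a \<noteq> c" "b \<noteq> c"
    and u: "u \<in> polygon vs" and v: "v \<in> polygon vs" and uv: "u \<noteq> v"
    and eqs: "u $ a + \<epsilon> * u $ c = v $ a + \<epsilon> * v $ c" "u $ b + \<delta> * u $ c = v $ b + \<delta> * v $ c"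
    and small: "\<bar>\<epsilon> * (v $ c - u $ c)\<bar> < 1" "\<bar>\<delta> * (v $ c - u $ c)\<bar> < 1"
    and nz: "\<epsilon> \<noteq> 0" "\<delta> \<noteq> 0"
  shows "u $ a \<notin> \<int> \<and> v $ b \<notin> \<int> \<or> u $ b \<notin> \<int> \<and> v $ a \<notin> \<int>"
proof -
  obtain k d where k: "u \<in> E k" "parallel_to d (E k)" using u by (rule polygon_in_E)
  obtain l e where l: "v \<in> E l" "parallel_to e (E l)" using v by (rule polygon_in_E)
  have c: "u $ c \<noteq> v $ c"
  proof
    assume "u $ c = v $ c"
    then have "u $ i = v $ i" for i using eqs axes[of i] by auto
    then show False using uv by (simp add: vec_eq_iff)
  qed
  have "\<epsilon> * (v $ c - u $ c) \<notin> \<int>" "\<delta> * (v $ c - u $ c) \<notin> \<int>"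
    using Ints_nonzero_abs_less1[OF _ small(1)] Ints_nonzero_abs_less1[OF _ small(2)] nz c by auto
  moreover have "\<epsilon> * (v $ c - u $ c) = u $ a - v $ a" "\<delta> * (v $ c - u $ c) = u $ b - v $ b"
    using eqs by (auto simp: algebra_simps)
  ultimately have "u $ a \<notin> \<int> \<or> v $ a \<notin> \<int>" "u $ b \<notin> \<int> \<or> v $ b \<notin> \<int>"
    using Ints_diff by metis+
  moreover have "u $ a \<in> \<int> \<or> u $ b \<in> \<int>" "v $ a \<in> \<int> \<or> v $ b \<in> \<int>"
    using E_int[OF k(2,1)] E_int[OF l(2,1)] ne(1) by metis+
  ultimately show ?thesis by blast
qed

text \<open>Being nonintegral in \<open>a\<close>, the point \<open>u\<close> lies on an
  \<open>a\<close>-edge. That edge has integral ends and comes closer than 1 to the corner, so it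
  contains the corner. Since the polygon turns there, the edge is \<open>E i\<close>, and
  \<open>u\<close> is on the side of \<open>V i\<close>.\<close>

lemma corner_side:
  assumes i: "parallel_to a (E i)" "\<not> parallel_to a (E (Suc i))"
    and u: "u \<in> polygon vs" "u $ a \<notin> \<int>" "\<And>m. m \<noteq> a \<Longrightarrow> u $ m = V (Suc i) $ m"
    and near: "\<bar>u $ a - V (Suc i) $ a\<bar> < 1"
  shows "(u $ a - V (Suc i) $ a) * (V i $ a - V (Suc i) $ a) > 0"
proof -
  obtain k d where k: "u \<in> E k" "parallel_to d (E k)" using u(1) by (rule polygon_in_E)
  have "a = d" using E_int[OF k(2,1)] u(2) by blast
  then have k: "u \<in> E k" "parallel_to a (E k)" using k by auto
  have coord: "u $ a \<in> closed_segment (V j $ a) (V (Suc j) $ a)" if "u \<in> E j" for j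
    using that unfolding E_def in_segment by auto
  have "V (Suc i) \<in> E k" unfolding E_def
  proof (rule closed_segment_parallel_mem[where d = a])
    show "V k $ m = V (Suc k) $ m" if "m \<noteq> a" for m
      by (rule parallel_toD[OF k(2) V_in_E that])
    show "V (Suc i) $ m = V k $ m" if "m \<noteq> a" for m
      using parallel_toD[OF k(2) k(1) V_in_E(1) that] u(3)[OF that] by simp
    show "V (Suc i) $ a \<in> closed_segment (V k $ a) (V (Suc k) $ a)"
      by (rule Ints_between[OF V_int V_int V_int u(2) near coord[OF k(1)]])
  qed
  from vertex_in_edge[OF this] have "E k = E i \<or> E k = E (Suc i)" using E_eq by blast
  then have "u \<in> E i" using k i(2) by auto
  from coord[OF this] obtain t where t: "t \<le> 1" "u $ a = (1 - t) * V i $ a + t * V (Suc i) $ a"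
    unfolding in_segment by auto
  have diff: "u $ a - V (Suc i) $ a = (1 - t) * (V i $ a - V (Suc i) $ a)"
    unfolding t(2) by (simp add: algebra_simps)
  have "u $ a \<noteq> V (Suc i) $ a" using u(2) V_int by metis
  then have "1 - t \<noteq> 0" "V i $ a - V (Suc i) $ a \<noteq> 0" using diff by auto
  then have "0 < (1 - t) * (V i $ a - V (Suc i) $ a)\<^sup>2" using t(1) by simp
  then show ?thesis unfolding diff by (simp add: power2_eq_square mult.assoc)
qed

end


section \<open>The tilting map and the crossings it produces\<close>

text \<open>Followed by \<open>plane_proj\<close> this is an oblique projection nearly along axis
  \<open>c\<close>. Keeping \<open>u $ c\<close> as third coordinate makes the map invertible, so
  that the projection direction in the definition of diagrams can stay fixed.\<close>

definition tilt :: "3 \<Rightarrow> 3 \<Rightarrow> 3 \<Rightarrow> real \<Rightarrow> real \<Rightarrow> real^3 \<Rightarrow> real^3" where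
  "tilt a b c \<epsilon> \<delta> u = vector [u $ a + \<epsilon> * u $ c, u $ b + \<delta> * u $ c, u $ c]"

lemma tilt_components [simp]:
  "tilt a b c \<epsilon> \<delta> u $ 1 = u $ a + \<epsilon> * u $ c"
  "tilt a b c \<epsilon> \<delta> u $ 2 = u $ b + \<delta> * u $ c"
  "tilt a b c \<epsilon> \<delta> u $ 3 = u $ c"
  by (simp_all add: tilt_def)

lemma linear_tilt: "linear (tilt a b c \<epsilon> \<delta>)"
  by (rule linearI) (simp_all add: vec_eq_iff forall_3 algebra_simps)

lemma inj_tilt:
  assumes "\<And>d. d = a \<or> d = b \<or> d = c"
  shows "inj (tilt a b c \<epsilon> \<delta>)"
proof (rule injI)
  fix u v assume eq: "tilt a b c \<epsilon> \<delta> u = tilt a b c \<epsilon> \<delta> v"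
  have "tilt a b c \<epsilon> \<delta> u $ k = tilt a b c \<epsilon> \<delta> v $ k" for k using eq by simp
  from this[of 1] this[of 2] this[of 3] have "u $ a = v $ a" "u $ b = v $ b" "u $ c = v $ c" by auto
  then have "u $ d = v $ d" for d using assms[of d] by auto
  then show "u = v" by (simp add: vec_eq_iff)
qed

lemma plane_proj_tilt_eq_iff:
  "plane_proj (tilt a b c \<epsilon> \<delta> u) = plane_proj (tilt a b c \<epsilon> \<delta> v) \<longleftrightarrow>
     u $ a + \<epsilon> * u $ c = v $ a + \<epsilon> * v $ c \<and> u $ b + \<delta> * u $ c = v $ b + \<delta> * v $ c"
  by (simp add: plane_proj_def vec_eq_iff forall_2)

context lattice_polygon
begin

lemma tilted_projection:
  assumes axes: "\<And>d. d = a \<or> d = b \<or> d = c" and ne: "a \<noteq> b" "a \<noteq> c" "b \<noteq> c"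
    and ncop: "\<not> coplanar (polygon vs)"
  obtains \<epsilon> \<delta> where
    "finite (multiple_points (tilt a b c \<epsilon> \<delta> ` polygon vs))"
    "\<And>p. p \<in> multiple_points (tilt a b c \<epsilon> \<delta> ` polygon vs) \<Longrightarrow>
       card {x \<in> tilt a b c \<epsilon> \<delta> ` polygon vs. plane_proj x = p} = 2"
    "\<And>v. v \<in> set vs \<Longrightarrow>
       plane_proj (tilt a b c \<epsilon> \<delta> v) \<notin> multiple_points (tilt a b c \<epsilon> \<delta> ` polygon vs)"
    "card (multiple_points (tilt a b c \<epsilon> \<delta> ` polygon vs)) + 2 \<le> card (X a) * card (X b)"
proof -
  obtain B where B: "0 < B" "\<And>u. u \<in> polygon vs \<Longrightarrow> norm u \<le> B"
    using compact_imp_bounded[OF compact_polygon] unfolding bounded_pos by blast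
  \<comment> \<open>Coordinates of two points of the polygon differ by at most \<open>2 * B\<close>,
    so tilting by this slope moves them by less than 1 relative to each other.\<close>
  define \<eta> where "\<eta> = 1 / (2 * B + 1)"
  have \<eta>: "0 < \<eta>" using B(1) by (simp add: \<eta>_def)
  obtain ka kb where kab: "parallel_to a (E ka)" "parallel_to b (E kb)"
    using edge_parallel_exists[OF ncop] by blast
  obtain i j where ij: "parallel_to a (E i)" "\<not> parallel_to a (E (Suc i))" "parallel_to b (E j)"
      "\<And>m. m \<noteq> c \<Longrightarrow> V (Suc i) $ m = V j $ m"
    using corner_exists[OF axes ne(1) kab] by blast
  have axes': "d = b \<or> d = a \<or> d = c" for d using axes[of d] by auto
  obtain i' j' where ij': "parallel_to b (E i')" "\<not> parallel_to b (E (Suc i'))" "parallel_to a (E j')"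
      "\<And>m. m \<noteq> c \<Longrightarrow> V (Suc i') $ m = V j' $ m"
    using corner_exists[OF axes' ne(1)[symmetric] kab(2,1)] by blast
  \<comment> \<open>A crossing of the two sticks at this corner would shift \<open>u\<close> from
    the corner by \<epsilon> times the first factor, while \<open>corner_side\<close> demands a
    shift towards \<open>V i\<close>. This sign of \<epsilon> excludes that; \<delta> does the same
    for the other corner.\<close>
  obtain \<epsilon> where \<epsilon>: "\<bar>\<epsilon>\<bar> = \<bar>\<eta>\<bar>"
      "\<epsilon> * ((V j $ c - V (Suc i) $ c) * (V i $ a - V (Suc i) $ a)) \<le> 0"
    by (rule small_with_sign)
  obtain \<delta> where \<delta>: "\<bar>\<delta>\<bar> = \<bar>\<eta>\<bar>"
      "\<delta> * ((V j' $ c - V (Suc i') $ c) * (V i' $ b - V (Suc i') $ b)) \<le> 0"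
    by (rule small_with_sign)
  have small: "\<bar>e * (v $ c - u $ c)\<bar> < 1"
    if "\<bar>e\<bar> = \<bar>\<eta>\<bar>" "u \<in> polygon vs" "v \<in> polygon vs" for e u v
  proof -
    have "\<bar>v $ c - u $ c\<bar> \<le> 2 * B"
      using B(2)[OF that(2)] B(2)[OF that(3)] component_le_norm_cart[of u c]
        component_le_norm_cart[of v c] by linarith
    then have "\<bar>e * (v $ c - u $ c)\<bar> \<le> 1 / (2 * B + 1) * (2 * B)"
      unfolding abs_mult that(1) using \<eta> B(1) by (intro mult_mono) (auto simp: \<eta>_def)
    also have "\<dots> < 1" using B(1) by (simp add: field_simps)
    finally show ?thesis .
  qed
  have nz: "\<epsilon> \<noteq> 0" "\<delta> \<noteq> 0" using \<epsilon>(1) \<delta>(1) \<eta> by auto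
  define f where "f = tilt a b c \<epsilon> \<delta>"
  define M where "M = multiple_points (f ` polygon vs)"
  have injf: "inj f" unfolding f_def using axes by (rule inj_tilt)
  have f_eq: "u $ a + \<epsilon> * u $ c = v $ a + \<epsilon> * v $ c" "u $ b + \<delta> * u $ c = v $ b + \<delta> * v $ c"
    if "plane_proj (f u) = plane_proj (f v)" for u v
    using that unfolding f_def plane_proj_tilt_eq_iff by auto
  have cross: "u $ a \<notin> \<int> \<and> v $ b \<notin> \<int> \<or> u $ b \<notin> \<int> \<and> v $ a \<notin> \<int>"
    if "u \<in> polygon vs" "v \<in> polygon vs" "u \<noteq> v" "plane_proj (f u) = plane_proj (f v)" for u v
    using crossing_coordinates[OF axes ne that(1-3) f_eq[OF that(4)]
        small[OF \<epsilon>(1) that(1,2)] small[OF \<delta>(1) that(1,2)] nz] .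
  have one: "u $ a \<in> \<int> \<or> u $ b \<in> \<int>" if u: "u \<in> polygon vs" for u
  proof -
    obtain k d where k: "u \<in> E k" "parallel_to d (E k)" using u by (rule polygon_in_E)
    then show ?thesis using E_int[OF k(2,1), of a] E_int[OF k(2,1), of b] ne(1) by blast
  qed
  have M_iff: "\<exists>u\<in>polygon vs. \<exists>v\<in>polygon vs. u \<noteq> v \<and> plane_proj (f u) = p \<and> plane_proj (f v) = p"
    if pM: "p \<in> M" for p
  proof -
    obtain x y where xy: "x \<in> f ` polygon vs" "y \<in> f ` polygon vs" "x \<noteq> y"
        "plane_proj x = p" "plane_proj y = p"
      using pM unfolding M_def multiple_points_def mem_Collect_eq by (elim bexE conjE)
    obtain u where u: "u \<in> polygon vs" "x = f u" using xy(1) by (elim imageE)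
    obtain v where v: "v \<in> polygon vs" "y = f v" using xy(2) by (elim imageE)
    have "u \<noteq> v" using xy(3) u(2) v(2) by (elim contrapos_nn) simp
    then show ?thesis using xy(4,5) u v by (intro bexI[of _ u] bexI[of _ v]) simp_all
  qed

  \<comment> \<open>Pigeonhole: any two points over \<open>p\<close> are nonintegral in different
    ones of \<open>a\<close> and \<open>b\<close>, and no point is nonintegral in both, so a third
    point is impossible.\<close>
  have card2: "card {x \<in> f ` polygon vs. plane_proj x = p} = 2" if pM: "p \<in> M" for p
  proof -
    obtain u v where uv: "u \<in> polygon vs" "v \<in> polygon vs" "u \<noteq> v"
        "plane_proj (f u) = p" "plane_proj (f v) = p"
      using M_iff[OF pM] by blast
    have "w = u \<or> w = v" if w: "w \<in> polygon vs" "plane_proj (f w) = p" for w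
    proof (rule ccontr)
      assume "\<not> (w = u \<or> w = v)"
      then have ne: "u \<noteq> w" "v \<noteq> w" by auto
      have eqs: "plane_proj (f u) = plane_proj (f v)" "plane_proj (f u) = plane_proj (f w)"
        "plane_proj (f v) = plane_proj (f w)"
        using uv(4,5) w(2) by simp_all
      show False
        using cross[OF uv(1-3) eqs(1)] cross[OF uv(1) w(1) ne(1) eqs(2)]
          cross[OF uv(2) w(1) ne(2) eqs(3)] one[OF uv(1)] one[OF uv(2)] one[OF w(1)] by blast
    qed
    then have "{x \<in> f ` polygon vs. plane_proj x = p} = {f u, f v}" using uv by blast
    moreover have "f u \<noteq> f v" using uv(3) injf by (simp add: inj_eq)
    ultimately show ?thesis by simp
  qed

  have vert: "plane_proj (f v) \<notin> M" if v: "v \<in> set vs" for v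
  proof
    assume "plane_proj (f v) \<in> M"
    then obtain u where u: "u \<in> polygon vs" "u \<noteq> v" "plane_proj (f v) = plane_proj (f u)"
      using M_iff[of "plane_proj (f v)"] by metis
    have "v \<in> polygon vs" using set_vs[OF v] V_in_polygon by blast
    from cross[OF this u(1) u(2)[symmetric] u(3)] show False using integral[OF v] by blast
  qed

  define R where "R p ST \<longleftrightarrow> (\<exists>u\<in>fst ST. \<exists>v\<in>snd ST. u \<in> polygon vs \<and> v \<in> polygon vs \<and>
      plane_proj (f u) = p \<and> plane_proj (f v) = p \<and> u $ a \<notin> \<int> \<and> v $ b \<notin> \<int>)" for p ST
  have R_ex: "\<exists>ST\<in>X a \<times> X b. R p ST" if pM: "p \<in> M" for p
  proof -
    obtain u v where uv: "u \<in> polygon vs" "v \<in> polygon vs"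
        "plane_proj (f u) = p" "plane_proj (f v) = p" "u $ a \<notin> \<int>" "v $ b \<notin> \<int>"
    proof -
      obtain u v where uv: "u \<in> polygon vs" "v \<in> polygon vs" "u \<noteq> v"
          "plane_proj (f u) = p" "plane_proj (f v) = p"
        using M_iff[OF pM] by blast
      from cross[OF uv(1-3)] uv(4,5) consider "u $ a \<notin> \<int> \<and> v $ b \<notin> \<int>" | "u $ b \<notin> \<int> \<and> v $ a \<notin> \<int>"
        by auto
      \<comment> \<open>The two cases differ only by exchanging the roles of \<open>u\<close> and
        \<open>v\<close>.\<close>
      then show thesis by cases (use that[of u v] that[of v u] uv in simp_all)
    qed
    obtain k d where k: "u \<in> E k" "parallel_to d (E k)" using uv(1) by (rule polygon_in_E)
    have "d = a" using E_int[OF k(2,1), of a] uv(5) by blast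
    then obtain S where S: "S \<in> X a" "u \<in> S" using X_over_E k by blast
    obtain l e where l: "v \<in> E l" "parallel_to e (E l)" using uv(2) by (rule polygon_in_E)
    have "e = b" using E_int[OF l(2,1), of b] uv(6) by blast
    then obtain T where T: "T \<in> X b" "v \<in> T" using X_over_E l by blast
    have "R p (S, T)" unfolding R_def fst_conv snd_conv using uv S(2) T(2) by blast
    then show ?thesis using S(1) T(1) by blast
  qed
  have Xpar: "u $ m = v $ m" if "S \<in> X d" "u \<in> S" "v \<in> S" "m \<noteq> d" for S d u v m
    using that parallel_toD unfolding X_def by blast
  \<comment> \<open>The stick along \<open>a\<close> fixes the second coordinate of the projected
    point and the stick along \<open>b\<close> fixes the first.\<close>
  have R_inj: "p = q" if R: "R p (S, T)" "R q (S, T)" and ST: "S \<in> X a" "T \<in> X b" for p q S T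
  proof -
    obtain u v where uv: "u \<in> S" "v \<in> T" "plane_proj (f u) = p" "plane_proj (f v) = p"
      using R(1) unfolding R_def fst_conv snd_conv by blast
    obtain u' v' where uv': "u' \<in> S" "v' \<in> T" "plane_proj (f u') = q" "plane_proj (f v') = q"
      using R(2) unfolding R_def fst_conv snd_conv by blast
    have "u $ b = u' $ b" "u $ c = u' $ c"
      by (rule Xpar[OF ST(1) uv(1) uv'(1)], rule ne[symmetric])+
    moreover have "v $ a = v' $ a" "v $ c = v' $ c"
      using Xpar[OF ST(2) uv(2) uv'(2) ne(1)] Xpar[OF ST(2) uv(2) uv'(2) ne(3)[symmetric]] .
    moreover have "plane_proj (f u) = plane_proj (f v)" "plane_proj (f u') = plane_proj (f v')"
      using uv(3,4) uv'(3,4) by auto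
    note f_eq[OF this(1)] f_eq[OF this(2)]
    ultimately have "plane_proj (f u) = plane_proj (f u')"
      unfolding f_def plane_proj_tilt_eq_iff by simp
    then show ?thesis using uv(3) uv'(3) by simp
  qed

  obtain S1 where S1: "S1 \<in> X a" "E i \<subseteq> S1" using X_over_E ij(1) by blast
  obtain T1 where T1: "T1 \<in> X b" "E j \<subseteq> T1" using X_over_E ij(3) by blast
  obtain S2 where S2: "S2 \<in> X a" "E j' \<subseteq> S2" using X_over_E ij'(3) by blast
  obtain T2 where T2: "T2 \<in> X b" "E i' \<subseteq> T2" using X_over_E ij'(1) by blast
  have mem: "V (Suc i) \<in> S1" "V j \<in> T1" "V j' \<in> S2" "V (Suc i') \<in> T2"
    using S1(2) T1(2) S2(2) T2(2) V_in_E by blast+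

  have no1: "\<not> R p (S1, T1)" for p
  proof
    assume "R p (S1, T1)"
    then obtain u v where uv: "u \<in> S1" "v \<in> T1" "u \<in> polygon vs" "v \<in> polygon vs"
        "plane_proj (f u) = plane_proj (f v)" "u $ a \<notin> \<int>"
      unfolding R_def fst_conv snd_conv by auto
    have u: "u $ m = V (Suc i) $ m" if "m \<noteq> a" for m
      by (rule Xpar[OF S1(1) uv(1) mem(1) that])
    have v: "v $ a = V j $ a" "v $ c = V j $ c"
      using Xpar[OF T1(1) uv(2) mem(2) ne(1)] Xpar[OF T1(1) uv(2) mem(2) ne(3)[symmetric]] .
    have eq: "u $ a - V (Suc i) $ a = \<epsilon> * (v $ c - u $ c)"
      using f_eq(1)[OF uv(5)] v(1) ij(4)[OF ne(2)] by (simp add: algebra_simps)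
    then have near: "\<bar>u $ a - V (Suc i) $ a\<bar> < 1" using small[OF \<epsilon>(1) uv(3,4)] by simp
    have "(u $ a - V (Suc i) $ a) * (V i $ a - V (Suc i) $ a) > 0"
      by (rule corner_side[OF ij(1,2) uv(3,6) u near])
    then show False using \<epsilon>(2) unfolding eq u[OF ne(2)[symmetric]] v(2) by (simp add: mult.assoc)
  qed
  have no2: "\<not> R p (S2, T2)" for p
  proof
    assume "R p (S2, T2)"
    then obtain u v where uv: "u \<in> S2" "v \<in> T2" "u \<in> polygon vs" "v \<in> polygon vs"
        "plane_proj (f u) = plane_proj (f v)" "v $ b \<notin> \<int>"
      unfolding R_def fst_conv snd_conv by auto
    have v: "v $ m = V (Suc i') $ m" if "m \<noteq> b" for m
      by (rule Xpar[OF T2(1) uv(2) mem(4) that])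
    have u: "u $ b = V j' $ b" "u $ c = V j' $ c"
      by (rule Xpar[OF S2(1) uv(1) mem(3)], rule ne[symmetric])+
    have eq: "v $ b - V (Suc i') $ b = \<delta> * (u $ c - v $ c)"
      using f_eq(2)[OF uv(5)] u(1) ij'(4)[OF ne(3)] by (simp add: algebra_simps)
    then have near: "\<bar>v $ b - V (Suc i') $ b\<bar> < 1" using small[OF \<delta>(1) uv(4,3)] by simp
    have "(v $ b - V (Suc i') $ b) * (V i' $ b - V (Suc i') $ b) > 0"
      by (rule corner_side[OF ij'(1,2) uv(4,6) v near])
    then show False using \<delta>(2) unfolding eq v[OF ne(3)[symmetric]] u(2) by (simp add: mult.assoc)
  qed
  \<comment> \<open>If the pairs agreed, the corners \<open>V (Suc i)\<close> and
    \<open>V j'\<close> would coincide, but the polygon leaves the first along a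
    non-\<open>a\<close> edge and the second along an \<open>a\<close>-edge.\<close>
  have distinct_pairs: "(S1, T1) \<noteq> (S2, T2)"
  proof
    assume "(S1, T1) = (S2, T2)"
    then have mem': "V j' \<in> S1" "V (Suc i') \<in> T1" using mem by auto
    have "V (Suc i) $ m = V j' $ m" if "m \<noteq> a" for m
      by (rule Xpar[OF S1(1) mem(1) mem'(1) that])
    moreover have "V (Suc i) $ a = V j' $ a"
      using ij(4)[OF ne(2)] ij'(4)[OF ne(2)] Xpar[OF T1(1) mem(2) mem'(2) ne(1)] by simp
    ultimately have "V (Suc i) $ m = V j' $ m" for m by (cases "m = a") auto
    then have "V (Suc i) = V j'" by (simp add: vec_eq_iff)
    then have "E (Suc i) = E j'" using E_eq V_eq_iff by blast
    then show False using ij(2) ij'(3) by simp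
  qed

  \<comment> \<open>Crossings inject into the stick pairs other than the two corner pairs.\<close>
  define P where "P = X a \<times> X b - {(S1, T1), (S2, T2)}"
  have "\<exists>ST. ST \<in> P \<and> R p ST" if "p \<in> M" for p
    using R_ex[OF that] no1 no2 unfolding P_def by blast
  then obtain g where g: "\<And>p. p \<in> M \<Longrightarrow> g p \<in> P \<and> R p (g p)" by metis
  have "inj_on g M"
  proof (rule inj_onI)
    fix p q assume pq: "p \<in> M" "q \<in> M" "g p = g q"
    obtain S T where ST: "g p = (S, T)" by (cases "g p")
    then have "R p (S, T)" "R q (S, T)" "(S, T) \<in> P" using g[OF pq(1)] g[OF pq(2)] pq(3) by auto
    then show "p = q" using R_inj unfolding P_def by blast
  qed
  moreover have "g ` M \<subseteq> P" using g by blast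
  moreover have finP: "finite (X a \<times> X b)" using finite_X by simp
  then have "finite P" unfolding P_def by simp
  ultimately have finM: "finite M" and cardM: "card M \<le> card P"
    by (auto intro: inj_on_finite card_inj_on_le)
  have two: "{(S1, T1), (S2, T2)} \<subseteq> X a \<times> X b" using S1 S2 T1 T2 by blast
  have "card {(S1, T1), (S2, T2)} = 2" using distinct_pairs by simp
  moreover from this have "card P = card (X a) * card (X b) - 2" unfolding P_def
    using card_Diff_subset[OF _ two] by (simp add: card_cartesian_product)
  \<comment> \<open>This keeps the natural subtraction of 2 from being truncated.\<close>
  moreover have "card {(S1, T1), (S2, T2)} \<le> card (X a) * card (X b)"
    using card_mono[OF finP two] by (simp add: card_cartesian_product)
  ultimately have bound: "card M + 2 \<le> card (X a) * card (X b)" using cardM by linarith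
  show ?thesis
    using that[of \<epsilon> \<delta>] finM card2 vert bound unfolding M_def f_def by auto
qed

end


section \<open>Tilting preserves the knot type\<close>

lemma ambient_isotopic_shear: "ambient_isotopic K (tilt 1 2 3 \<epsilon> \<delta> ` K)"
proof (rule ambient_isotopic_linear[OF linear_tilt])
  fix t :: real and x :: "real^3"
  assume "(1 - t) *\<^sub>R x + t *\<^sub>R tilt 1 2 3 \<epsilon> \<delta> x = 0"
  then have eq: "((1 - t) *\<^sub>R x + t *\<^sub>R tilt 1 2 3 \<epsilon> \<delta> x) $ i = 0" for i by simp
  have "x $ 3 = 0" using eq[of 3] by (simp add: algebra_simps)
  then have "x $ 1 = 0" "x $ 2 = 0" using eq[of 1] eq[of 2] by (simp_all add: algebra_simps)
  with \<open>x $ 3 = 0\<close> show "x = 0" by (simp add: vec_eq_iff forall_3)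
qed

text \<open>The matrix interpolating between the identity and a 3-cycle has determinant
  \<open>s ^ 3 + t ^ 3\<close>, which is positive; the combination in the proof eliminates
  \<open>y\<close> and \<open>z\<close>.\<close>

lemma cyclic_system_zero:
  fixes s t x y z :: real
  assumes "0 \<le> s" "0 \<le> t" "s + t = 1" "s * x + t * y = 0" "s * y + t * z = 0" "s * z + t * x = 0"
  shows "x = 0"
proof -
  have "(s ^ 3 + t ^ 3) * x = s\<^sup>2 * (s * x + t * y) - s * t * (s * y + t * z) + t\<^sup>2 * (s * z + t * x)"
    by (simp add: algebra_simps power2_eq_square power3_eq_cube)
  then have "(s ^ 3 + t ^ 3) * x = 0" using assms by simp
  moreover have "s ^ 3 + t ^ 3 > 0"
  proof (cases "s = 0")
    case False
    then show ?thesis using assms by (intro add_pos_nonneg) auto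
  qed (use assms in simp)
  ultimately show ?thesis by simp
qed

definition cyclic_axes :: "3 \<Rightarrow> 3 \<Rightarrow> 3 \<Rightarrow> bool" where
  "cyclic_axes a b c \<longleftrightarrow> (a, b, c) \<in> {(1, 2, 3), (2, 3, 1), (3, 1, 2)}"

lemma ambient_isotopic_cyclic:
  assumes "cyclic_axes a b c"
  shows "ambient_isotopic K (tilt a b c 0 0 ` K)"
proof (rule ambient_isotopic_linear[OF linear_tilt])
  fix t :: real and x :: "real^3"
  assume t: "0 \<le> t" "t \<le> 1" and "(1 - t) *\<^sub>R x + t *\<^sub>R tilt a b c 0 0 x = 0"
  then have eq: "((1 - t) *\<^sub>R x + t *\<^sub>R tilt a b c 0 0 x) $ i = 0" for i by simp
  have eqs: "(1 - t) * x $ 1 + t * x $ a = 0" "(1 - t) * x $ 2 + t * x $ b = 0"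
    "(1 - t) * x $ 3 + t * x $ c = 0"
    using eq[of 1] eq[of 2] eq[of 3] by simp_all
  have s: "0 \<le> 1 - t" "1 - t + t = 1" using t by auto
  note cyc = cyclic_system_zero[OF s(1) t(1) s(2)]
  consider "a = 1" "b = 2" "c = 3" | "a = 2" "b = 3" "c = 1" | "a = 3" "b = 1" "c = 2"
    using assms unfolding cyclic_axes_def by auto
  then have "x $ 1 = 0 \<and> x $ 2 = 0 \<and> x $ 3 = 0"
  proof cases
    case 1
    show ?thesis using eqs unfolding 1 by (simp add: algebra_simps)
  next
    case 2
    note e = eqs[unfolded 2]
    show ?thesis using cyc[OF e(1,2,3)] cyc[OF e(2,3,1)] cyc[OF e(3,1,2)] by blast
  next
    case 3
    note e = eqs[unfolded 3]
    show ?thesis using cyc[OF e(1,3,2)] cyc[OF e(2,1,3)] cyc[OF e(3,2,1)] by blast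
  qed
  then show "x = 0" by (simp add: vec_eq_iff forall_3)
qed

text \<open>A tilt is a cyclic permutation of the coordinates followed by a shear.\<close>

lemma ambient_isotopic_tilt:
  assumes "cyclic_axes a b c"
  shows "ambient_isotopic K (tilt a b c \<epsilon> \<delta> ` K)"
proof -
  have "tilt a b c \<epsilon> \<delta> u = tilt 1 2 3 \<epsilon> \<delta> (tilt a b c 0 0 u)" for u
    by (simp add: vec_eq_iff forall_3)
  then have "tilt a b c \<epsilon> \<delta> ` K = tilt 1 2 3 \<epsilon> \<delta> ` tilt a b c 0 0 ` K"
    by (simp add: image_image)
  then show ?thesis
    using ambient_isotopic_trans[OF ambient_isotopic_cyclic[OF assms] ambient_isotopic_shear] by metis
qed

lemma edge_map:
  assumes "linear f" "i < length vs"
  shows "edge (map f vs) i = f ` edge vs i"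
proof -
  have "Suc i mod length vs < length vs" using assms(2) by (intro mod_less_divisor) linarith
  then show ?thesis using assms by (simp add: edge_def closed_segment_linear_image)
qed

lemma polygon_map:
  assumes "linear f"
  shows "polygon (map f vs) = f ` polygon vs"
  using edge_map[OF assms, of _ vs] by (simp add: polygon_def image_UN)

lemma simple_polygon_map:
  assumes f: "linear f" "inj f" and vs: "simple_polygon vs"
  shows "simple_polygon (map f vs)"
  unfolding simple_polygon_def
proof (intro conjI allI impI)
  show "3 \<le> length (map f vs)" "distinct (map f vs)"
    using vs f(2) by (auto simp: simple_polygon_def distinct_map intro: inj_on_subset)
  fix i j assume ij: "i < length (map f vs)" "j < length (map f vs)" "i \<noteq> j"
  have lt: "Suc k mod length vs < length vs" for k using ij by (intro mod_less_divisor) auto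
  have "edge vs i \<inter> edge vs j =
      {vs ! i, vs ! (Suc i mod length vs)} \<inter> {vs ! j, vs ! (Suc j mod length vs)}"
    using vs ij by (simp add: simple_polygon_def)
  then have "f ` edge vs i \<inter> f ` edge vs j =
      f ` {vs ! i, vs ! (Suc i mod length vs)} \<inter> f ` {vs ! j, vs ! (Suc j mod length vs)}"
    by (simp only: image_Int[OF f(2), symmetric])
  then show "edge (map f vs) i \<inter> edge (map f vs) j =
      {map f vs ! i, map f vs ! (Suc i mod length (map f vs))} \<inter>
      {map f vs ! j, map f vs ! (Suc j mod length (map f vs))}"
    using ij lt by (simp add: edge_map[OF f(1)])
qed

section \<open>From crossings to the stick index\<close>

lemma (in lattice_polygon) crossing_number_bound:
  assumes cyc: "cyclic_axes a b c" and mem: "polygon vs \<in> knot_type K"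
    and ncop: "\<not> coplanar (polygon vs)"
  shows "crossing_number (knot_type K) + 2 \<le> card (X a) * card (X b)"
proof -
  have axes: "d = a \<or> d = b \<or> d = c" for d
    using cyc exhaust_3[of d] unfolding cyclic_axes_def by auto
  have ne: "a \<noteq> b" "a \<noteq> c" "b \<noteq> c" using cyc unfolding cyclic_axes_def by auto
  obtain \<epsilon> \<delta> where fin: "finite (multiple_points (tilt a b c \<epsilon> \<delta> ` polygon vs))"
    and double: "\<And>p. p \<in> multiple_points (tilt a b c \<epsilon> \<delta> ` polygon vs) \<Longrightarrow>
       card {x \<in> tilt a b c \<epsilon> \<delta> ` polygon vs. plane_proj x = p} = 2"
    and vert: "\<And>v. v \<in> set vs \<Longrightarrow>
       plane_proj (tilt a b c \<epsilon> \<delta> v) \<notin> multiple_points (tilt a b c \<epsilon> \<delta> ` polygon vs)"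
    and bound: "card (multiple_points (tilt a b c \<epsilon> \<delta> ` polygon vs)) + 2 \<le> card (X a) * card (X b)"
    using tilted_projection[OF axes ne ncop] by blast
  define f where "f = tilt a b c \<epsilon> \<delta>"
  have lin: "linear f" and inj: "inj f"
    unfolding f_def using linear_tilt inj_tilt[OF axes] by auto
  have simple': "simple_polygon (map f vs)" using simple_polygon_map[OF lin inj simple] .
  have poly: "polygon (map f vs) = f ` polygon vs" using polygon_map[OF lin] .
  have "ambient_isotopic K (f ` polygon vs)"
    using mem ambient_isotopic_trans ambient_isotopic_tilt[OF cyc] unfolding knot_type_def f_def by blast
  then have "polygon (map f vs) \<in> knot_type K"
    unfolding knot_type_def polygonal_knot_def using simple' poly by auto
  moreover have "regular_position (map f vs)"
    unfolding regular_position_def poly using fin double vert unfolding f_def[symmetric] by auto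
  ultimately have "crossing_number (knot_type K) \<le> card (multiple_points (polygon (map f vs)))"
    unfolding crossing_number_def using simple' by (intro Least_le) blast
  then show ?thesis using bound unfolding poly f_def[symmetric] by linarith
qed

lemma stick_number_bound:
  assumes nontrivial: "\<not> trivial_knot_type (knot_type K)"
    and L: "L \<in> knot_type K" "lattice_stick_conformation L"
  shows "3 * sqrt (real (crossing_number (knot_type K)) + 2) \<le> real (stick_number L)"
proof -
  obtain vs where vs: "simple_polygon vs" "\<forall>v\<in>set vs. \<forall>i. v $ i \<in> \<int>" "L = polygon vs"
    using L(2) unfolding lattice_stick_conformation_def by blast
  interpret lattice_polygon vs
    using vs L(2) unfolding lattice_stick_conformation_def by unfold_locales auto
  have ncop: "\<not> coplanar (polygon vs)"
    using nontrivial L(1) vs(3) unfolding trivial_knot_type_def by blast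
  note bound = crossing_number_bound[OF _ L(1)[unfolded vs(3)] ncop]
  define x y z m where "x = real (card (X 1))" and "y = real (card (X 2))" and "z = real (card (X 3))"
    and "m = real (crossing_number (knot_type K)) + 2"
  have "m \<le> real (card (X a)) * real (card (X b))" if "cyclic_axes a b c" for a b c
    using of_nat_mono[OF bound[OF that], where ?'a = real] by (simp add: m_def)
  from this[of 1 2 3] this[of 2 3 1] this[of 3 1 2]
  have "m \<le> x * y" "m \<le> y * z" "m \<le> z * x"
    unfolding x_def y_def z_def cyclic_axes_def by simp_all
  then have "9 * m \<le> 3 * (x * y + y * z + z * x)" by simp
  \<comment> \<open>Summing \<open>2 * x * y \<le> x\<^sup>2 + y\<^sup>2\<close> over the three
    pairs bounds the mixed products by the squares.\<close>
  also have "\<dots> \<le> (x + y + z)\<^sup>2"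
    using sum_squares_bound[of x y] sum_squares_bound[of y z] sum_squares_bound[of z x]
    by (simp add: power2_eq_square algebra_simps)
  finally have "sqrt (9 * m) \<le> x + y + z"
    by (intro real_le_lsqrt) (simp_all add: x_def y_def z_def)
  moreover have "x + y + z \<le> real (stick_number L)"
    using card_X_sum unfolding x_def y_def z_def vs(3) by linarith
  moreover have "sqrt (9 * m) = 3 * sqrt m" by (simp add: real_sqrt_mult)
  ultimately show ?thesis unfolding m_def by linarith
qed

theorem theorem5p1:
  fixes K :: "(real^3) set"
  assumes "polygonal_knot K"
    and "\<not> trivial_knot_type (knot_type K)"
  shows "ereal_of_enat (lattice_stick_index (knot_type K))
           \<ge> ereal (3 * sqrt (real (crossing_number (knot_type K)) + 2))"
proof -
  let ?A = "{L \<in> knot_type K. lattice_stick_conformation L}"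
  show ?thesis
  proof (cases "?A = {}")
    \<comment> \<open>The infimum over the empty set is infinite, so the bound is trivial.\<close>
    case True
    then have "lattice_stick_index (knot_type K) = \<infinity>"
      unfolding lattice_stick_index_def by (simp add: Inf_enat_def)
    then show ?thesis by simp
  next
    case False
    \<comment> \<open>A nonempty set of extended naturals attains its infimum.\<close>
    then have "lattice_stick_index (knot_type K) \<in> (\<lambda>L. enat (stick_number L)) ` ?A"
      unfolding lattice_stick_index_def Inf_enat_def by (auto intro: LeastI2)
    then obtain L where L: "L \<in> knot_type K" "lattice_stick_conformation L"
        "lattice_stick_index (knot_type K) = enat (stick_number L)"
      by blast
    then show ?thesis using stick_number_bound[OF assms(2) L(1,2)] by simp
  qed
qed

end
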